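(* Consider a local dependency exponential random graph model with blocks $A_1,\dots,A_K$ and statistics $s_{k,k}:\mathbb{X}_{k,k}\to\mathbb{R}^{d_1}$, $s_{k,l}:\mathbb{X}_{k,l}\to\mathbb{R}^{d_2}$ ($k<l$), as in the context. For every observed graph $x\in\mathbb{X}$, the LERGM-Stein estimator obtained from the test functions $f_{k,l}=s_{k,l}$ equals the maximum pseudo-likelihood estimator. That is, $\hat\beta=(\hat\beta_W,\hat\beta_B)\in\mathbb{R}^{d_1}\times\mathbb{R}^{d_2}$ satisfies $\hat\beta_W\in\operatorname{argmin}_{\beta_W\in\mathbb{R}^{d_1}}G_W(x,\beta_W)$ and $\hat\beta_B\in\operatorname{argmin}_{\beta_B\in\mathbb{R}^{d_2}}G_B(x,\beta_B)$ if and only if $\hat\beta$ maximises over $\beta\in\mathbb{R}^{d_1}\times\mathbb{R}^{d_2}$ the log-pseudo-likelihood $$\sum_{1\le k\le l\le K}\ \sum_{m\in E_{k,l}}\log p_\beta\big(x_{k,l}\,\big|\,(x_{k,l})_{-m}\big).$$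
   Context: A finite vertex set $A$ is partitioned into $K$ nonempty blocks $A_1,\dots,A_K$. $E_{k,k}$ is the set of unordered pairs of distinct vertices of $A_k$; for $k<l$, $E_{k,l}$ is the set of pairs $(u,v)$ with $u\in A_k$, $v\in A_l$. $\mathbb{X}_{k,l}=\{0,1\}^{E_{k,l}}$ and $\mathbb{X}=\prod_{1\le k\le l\le K}\mathbb{X}_{k,l}$ is the set of simple undirected graphs on $A$; $x=(x_{k,l})_{k\le l}$. For $m\in E_{k,l}$, $\Diamond_m^1x_{k,l}$ (resp. $\Diamond_m^0x_{k,l}$) is $x_{k,l}$ with the indicator of edge $m$ set to $1$ (resp. $0$), and $\Delta_mf(x_{k,l})=f(\Diamond_m^1x_{k,l})-f(\Diamond_m^0x_{k,l})$. $\mathrm{LERGM}(\beta)$, $\beta=(\beta_W,\beta_B)\in\mathbb{R}^{d_1}\times\mathbb{R}^{d_2}$, is the probability distribution on $\mathbb{X}$ with $p_\beta(x)\propto\exp\big(\sum_{1\le k\le K}\langle\beta_W,s_{k,k}(x_{k,k})\rangle+\sum_{1\le k<l\le K}\langle\beta_B,s_{k,l}(x_{k,l})\rangle\big)$. $(x_{k,l})_{-m}$ is the collection of edge indicators of $x_{k,l}$ except that of edge $m$, and $p_\beta(x_{k,l}\mid(x_{k,l})_{-m})$ is the conditional probability under $\mathbf{X}\sim\mathrm{LERGM}(\beta)$ that $\mathbf{X}_{k,l}=x_{k,l}$ given that $(\mathbf{X}_{k,l})_{-m}=(x_{k,l})_{-m}$. With $\Sigma(t)=\log(1+e^t)$,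 $$G_W(x,\beta_W)=\sum_{1\le k\le K}\sum_{m\in E_{k,k}}\big(\Sigma(\langle\beta_W,\Delta_ms_{k,k}(x_{k,k})\rangle)+\langle\beta_W,s_{k,k}(\Diamond_m^0x_{k,k})-s_{k,k}(x_{k,k})\rangle\big),$$ $$G_B(x,\beta_B)=\sum_{1\le k<l\le K}\sum_{m\in E_{k,l}}\big(\Sigma(\langle\beta_B,\Delta_ms_{k,l}(x_{k,l})\rangle)+\langle\beta_B,s_{k,l}(\Diamond_m^0x_{k,l})-s_{k,l}(x_{k,l})\rangle\big).$$ The LERGM-Stein estimator is a minimiser of these functions; equivalently a zero of their gradients, which are the Stein estimating equations with test functions $f_{k,l}=s_{k,l}$, namely $\sum_{k}\sum_{m\in E_{k,k}}(\sigma(\langle\beta_W,\Delta_ms_{k,k}(x_{k,k})\rangle)\Delta_ms_{k,k}(x_{k,k})+s_{k,k}(\Diamond_m^0x_{k,k})-s_{k,k}(x_{k,k}))=0$ and the analogous equation over $k<l$ for $\beta_B$, where $\sigma(t)=1/(1+e^{-t})$. *)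

theory Defs
  imports "HOL-Probability.Probability"
begin

text \<open>
  A graph is a family of edge indicators, indexed by pairs of blocks. An edge is represented by
  the set of its two endpoints, both within a block and between two blocks; since the blocks are
  disjoint, for \<open>k < l\<close> the sets \<open>{u, v}\<close> with \<open>u \<in> A\<^sub>k\<close>, \<open>v \<in> A\<^sub>l\<close> correspond bijectively to the pairs
  \<open>(u, v)\<close>.
\<close>

type_synonym 'a config = "'a set \<Rightarrow> nat"
type_synonym 'a graph = "nat \<times> nat \<Rightarrow> 'a config"

definition block_partition :: "'a set \<Rightarrow> nat \<Rightarrow> (nat \<Rightarrow> 'a set) \<Rightarrow> bool" where
  "block_partition V K A \<longleftrightarrow>
     finite V \<and> inj_on A {1..K} \<and> partition_on V (A ` {1..K})"

definition edges :: "(nat \<Rightarrow> 'a set) \<Rightarrow> nat \<Rightarrow> nat \<Rightarrow> 'a set set" where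
  "edges A k l = {{u, v} | u v. u \<in> A k \<and> v \<in> A l \<and> u \<noteq> v}"

definition configs :: "(nat \<Rightarrow> 'a set) \<Rightarrow> nat \<Rightarrow> nat \<Rightarrow> 'a config set" where
  "configs A k l = edges A k l \<rightarrow>\<^sub>E {0, 1}"

definition graphs :: "(nat \<Rightarrow> 'a set) \<Rightarrow> nat \<Rightarrow> 'a graph set" where
  "graphs A K = (\<Pi>\<^sub>E (k, l) \<in> {(k, l). 1 \<le> k \<and> k \<le> l \<and> l \<le> K}. configs A k l)"

definition edge_diff :: "'a set \<Rightarrow> ('a config \<Rightarrow> 'v::ab_group_add) \<Rightarrow> 'a config \<Rightarrow> 'v" where
  "edge_diff m f y = f (y(m := 1)) - f (y(m := 0))"

text \<open>
  Below, \<open>sW k\<close> is the within-block statistic of block \<open>k\<close>, and \<open>sB k l\<close> (used only for \<open>k < l\<close>) is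
  the between-block statistic of blocks \<open>k\<close> and \<open>l\<close>.
\<close>

definition lergm_exponent ::
  "nat \<Rightarrow> (nat \<Rightarrow> 'a config \<Rightarrow> real ^ 'd1) \<Rightarrow> (nat \<Rightarrow> nat \<Rightarrow> 'a config \<Rightarrow> real ^ 'd2) \<Rightarrow>
   (real ^ 'd1) \<times> (real ^ 'd2) \<Rightarrow> 'a graph \<Rightarrow> real" where
  "lergm_exponent K sW sB \<beta> x =
     (\<Sum>k=1..K. fst \<beta> \<bullet> sW k (x (k, k))) + (\<Sum>k=1..K. \<Sum>l=k+1..K. snd \<beta> \<bullet> sB k l (x (k, l)))"

definition LERGM ::
  "(nat \<Rightarrow> 'a set) \<Rightarrow> nat \<Rightarrow> (nat \<Rightarrow> 'a config \<Rightarrow> real ^ 'd1) \<Rightarrow>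
   (nat \<Rightarrow> nat \<Rightarrow> 'a config \<Rightarrow> real ^ 'd2) \<Rightarrow> (real ^ 'd1) \<times> (real ^ 'd2) \<Rightarrow> 'a graph pmf" where
  "LERGM A K sW sB \<beta> = embed_pmf (\<lambda>x.
     if x \<in> graphs A K
     then exp (lergm_exponent K sW sB \<beta> x) / (\<Sum>y\<in>graphs A K. exp (lergm_exponent K sW sB \<beta> y))
     else 0)"

definition cond_config_prob ::
  "(nat \<Rightarrow> 'a set) \<Rightarrow> nat \<Rightarrow> (nat \<Rightarrow> 'a config \<Rightarrow> real ^ 'd1) \<Rightarrow>
   (nat \<Rightarrow> nat \<Rightarrow> 'a config \<Rightarrow> real ^ 'd2) \<Rightarrow> (real ^ 'd1) \<times> (real ^ 'd2) \<Rightarrow>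
   nat \<Rightarrow> nat \<Rightarrow> 'a set \<Rightarrow> 'a graph \<Rightarrow> real" where
  "cond_config_prob A K sW sB \<beta> k l m x =
     cond_prob (measure_pmf (LERGM A K sW sB \<beta>))
       (\<lambda>X. X (k, l) = x (k, l))
       (\<lambda>X. restrict (X (k, l)) (edges A k l - {m}) = restrict (x (k, l)) (edges A k l - {m}))"

definition log_pseudo_likelihood ::
  "(nat \<Rightarrow> 'a set) \<Rightarrow> nat \<Rightarrow> (nat \<Rightarrow> 'a config \<Rightarrow> real ^ 'd1) \<Rightarrow>
   (nat \<Rightarrow> nat \<Rightarrow> 'a config \<Rightarrow> real ^ 'd2) \<Rightarrow> 'a graph \<Rightarrow> (real ^ 'd1) \<times> (real ^ 'd2) \<Rightarrow> real" where
  "log_pseudo_likelihood A K sW sB x \<beta> =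
     (\<Sum>k=1..K. \<Sum>l=k..K. \<Sum>m\<in>edges A k l. ln (cond_config_prob A K sW sB \<beta> k l m x))"

definition softplus :: "real \<Rightarrow> real" where
  "softplus t = ln (1 + exp t)"

definition stein_W ::
  "(nat \<Rightarrow> 'a set) \<Rightarrow> nat \<Rightarrow> (nat \<Rightarrow> 'a config \<Rightarrow> real ^ 'd1) \<Rightarrow> 'a graph \<Rightarrow> real ^ 'd1 \<Rightarrow> real" where
  "stein_W A K sW x \<beta>W = (\<Sum>k=1..K. \<Sum>m\<in>edges A k k.
     softplus (\<beta>W \<bullet> edge_diff m (sW k) (x (k, k)))
     + \<beta>W \<bullet> (sW k ((x (k, k))(m := 0)) - sW k (x (k, k))))"

definition stein_B ::
  "(nat \<Rightarrow> 'a set) \<Rightarrow> nat \<Rightarrow> (nat \<Rightarrow> nat \<Rightarrow> 'a config \<Rightarrow> real ^ 'd2) \<Rightarrow> 'a graph \<Rightarrow>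
   real ^ 'd2 \<Rightarrow> real" where
  "stein_B A K sB x \<beta>B = (\<Sum>k=1..K. \<Sum>l=k+1..K. \<Sum>m\<in>edges A k l.
     softplus (\<beta>B \<bullet> edge_diff m (sB k l) (x (k, l)))
     + \<beta>B \<bullet> (sB k l ((x (k, l))(m := 0)) - sB k l (x (k, l))))"

definition lergm_stein_estimator ::
  "(nat \<Rightarrow> 'a set) \<Rightarrow> nat \<Rightarrow> (nat \<Rightarrow> 'a config \<Rightarrow> real ^ 'd1) \<Rightarrow>
   (nat \<Rightarrow> nat \<Rightarrow> 'a config \<Rightarrow> real ^ 'd2) \<Rightarrow> 'a graph \<Rightarrow> (real ^ 'd1) \<times> (real ^ 'd2) \<Rightarrow> bool" where
  "lergm_stein_estimator A K sW sB x \<beta> \<longleftrightarrow>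
     is_arg_min (stein_W A K sW x) (\<lambda>_. True) (fst \<beta>) \<and>
     is_arg_min (stein_B A K sB x) (\<lambda>_. True) (snd \<beta>)"

definition max_pseudo_likelihood_estimator ::
  "(nat \<Rightarrow> 'a set) \<Rightarrow> nat \<Rightarrow> (nat \<Rightarrow> 'a config \<Rightarrow> real ^ 'd1) \<Rightarrow>
   (nat \<Rightarrow> nat \<Rightarrow> 'a config \<Rightarrow> real ^ 'd2) \<Rightarrow> 'a graph \<Rightarrow> (real ^ 'd1) \<times> (real ^ 'd2) \<Rightarrow> bool" where
  "max_pseudo_likelihood_estimator A K sW sB x \<beta> \<longleftrightarrow>
     is_arg_max (log_pseudo_likelihood A K sW sB x) (\<lambda>_. True) \<beta>"

text \<open>The argument of \<^const>\<open>embed_pmf\<close> in \<open>LERGM\<close> is a probability mass function.\<close>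

lemma finite_graphs:
  assumes "block_partition V K A"
  shows "finite (graphs A K)"
proof -
  have fA: "finite (A k)" if "1 \<le> k" "k \<le> K" for k
  proof -
    have "A k \<subseteq> V"
      using assms that unfolding block_partition_def partition_on_def by auto
    then show ?thesis
      using assms finite_subset unfolding block_partition_def by blast
  qed
  have "finite (edges A k l)" if "1 \<le> k" "k \<le> l" "l \<le> K" for k l
  proof (rule finite_subset)
    show "edges A k l \<subseteq> (\<lambda>(u, v). {u, v}) ` (A k \<times> A l)"
      unfolding edges_def by auto
    show "finite ((\<lambda>(u, v). {u, v}) ` (A k \<times> A l))"
      using fA that by auto
  qed
  then have fin: "finite (configs A k l)" if "1 \<le> k" "k \<le> l" "l \<le> K" for k l
    using that unfolding configs_def by (auto intro: finite_PiE)
  have "finite {(k, l). 1 \<le> k \<and> k \<le> l \<and> l \<le> K}"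
    by (rule finite_subset[of _ "{1..K} \<times> {1..K}"]) auto
  then show ?thesis
    unfolding graphs_def using fin by (auto intro!: finite_PiE)
qed

lemma graphs_nonempty: "graphs A K \<noteq> {}"
  unfolding graphs_def configs_def by (auto simp: PiE_eq_empty_iff)

lemma pmf_LERGM:
  assumes "block_partition V K A"
  shows "pmf (LERGM A K sW sB \<beta>) x =
    (if x \<in> graphs A K
     then exp (lergm_exponent K sW sB \<beta> x) / (\<Sum>y\<in>graphs A K. exp (lergm_exponent K sW sB \<beta> y))
     else 0)"
proof -
  define Z where "Z = (\<Sum>y\<in>graphs A K. exp (lergm_exponent K sW sB \<beta> y))"
  define f where "f x = (if x \<in> graphs A K then exp (lergm_exponent K sW sB \<beta> x) / Z else 0)" for x
  note fin = finite_graphs[OF assms]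
  have Z: "Z > 0"
    unfolding Z_def using fin graphs_nonempty by (intro sum_pos) auto
  have nn: "f x \<ge> 0" for x
    using Z by (simp add: f_def)
  have "(\<integral>\<^sup>+ x. ennreal (f x) \<partial>count_space UNIV) = (\<Sum>x\<in>graphs A K. ennreal (f x))"
    using fin by (intro nn_integral_count_space') (auto simp: f_def)
  also have "\<dots> = ennreal (\<Sum>x\<in>graphs A K. f x)"
    using nn by (intro sum_ennreal) auto
  also have "(\<Sum>x\<in>graphs A K. f x) = Z / Z"
    by (simp add: f_def sum_divide_distrib[symmetric] Z_def[symmetric])
  finally have "(\<integral>\<^sup>+ x. ennreal (f x) \<partial>count_space UNIV) = 1"
    using Z by simp
  then have "pmf (embed_pmf f) x = f x"
    by (intro pmf_embed_pmf nn) auto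
  then show ?thesis
    unfolding LERGM_def f_def Z_def by simp
qed

end

theory Submission
  imports Defs
begin

text \<open>
  The exponent of the model is a sum with one term for each pair of blocks \<open>k \<le> l\<close>, so the
  configurations of the different pairs are independent and the law of \<open>X (k, l)\<close> is proportional
  to \<open>exp (block_weight sW sB \<beta> k l y)\<close> (lemma \<open>config_prob\<close>). Knowing all edges of \<open>X (k, l)\<close> but
  \<open>m\<close> leaves two configurations, with \<open>m\<close> present or absent, so the conditional probability has
  the logistic form \<open>exp s / (exp s\<^sub>1 + exp s\<^sub>0)\<close>, where \<open>s\<close>, \<open>s\<^sub>1\<close>, \<open>s\<^sub>0\<close> are the weights of the
  observed configuration and of these two. The intractable normalising constant has cancelled, and
  \<open>-ln (exp s / (exp s\<^sub>1 + exp s\<^sub>0)) = softplus (s\<^sub>1 - s\<^sub>0) + (s\<^sub>0 - s)\<close>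
  is exactly the term of \<open>m\<close> in the Stein objective. Hence the log-pseudo-likelihood is
  \<open>-(stein_W (fst \<beta>) + stein_B (snd \<beta>))\<close> (lemma \<open>log_pseudo_likelihood_eq\<close>). As the two
  summands depend on separate parameters, their sum is minimised exactly when each of them is.
\<close>

definition block_weight ::
  "(nat \<Rightarrow> 'a config \<Rightarrow> real ^ 'd1) \<Rightarrow> (nat \<Rightarrow> nat \<Rightarrow> 'a config \<Rightarrow> real ^ 'd2) \<Rightarrow>
   (real ^ 'd1) \<times> (real ^ 'd2) \<Rightarrow> nat \<Rightarrow> nat \<Rightarrow> 'a config \<Rightarrow> real" where
  "block_weight sW sB \<beta> k l y = (if k = l then fst \<beta> \<bullet> sW k y else snd \<beta> \<bullet> sB k l y)"

lemma sum_triangle_split: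
  fixes f :: "nat \<Rightarrow> nat \<Rightarrow> 'b::comm_monoid_add"
  shows "(\<Sum>k=1..K. \<Sum>l=k..K. f k l) = (\<Sum>k=1..K. f k k) + (\<Sum>k=1..K. \<Sum>l=k+1..K. f k l)"
proof -
  have "(\<Sum>k=1..K. \<Sum>l=k..K. f k l) = (\<Sum>k=1..K. f k k + (\<Sum>l=k+1..K. f k l))"
    by (intro sum.cong) (auto simp: sum.atLeast_Suc_atMost)
  then show ?thesis
    by (simp add: sum.distrib)
qed

lemma lergm_exponent_eq_sum_block_weight:
  "lergm_exponent K sW sB \<beta> x =
    (\<Sum>(k, l)\<in>(SIGMA k:{1..K}. {k..K}). block_weight sW sB \<beta> k l (x (k, l)))"
  by (simp add: sum.Sigma[symmetric] sum_triangle_split[unfolded One_nat_def]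
      lergm_exponent_def block_weight_def)

lemma lergm_exponent_upd:
  assumes "1 \<le> k" "k \<le> l" "l \<le> K"
  shows "lergm_exponent K sW sB \<beta> (X((k, l) := y)) =
    lergm_exponent K sW sB \<beta> X - block_weight sW sB \<beta> k l (X (k, l)) + block_weight sW sB \<beta> k l y"
proof -
  let ?P = "SIGMA k:{1..K}. {k..K}"
  have kl: "(k, l) \<in> ?P"
    using assms by auto
  have "(\<Sum>(i, j)\<in>?P - {(k, l)}. block_weight sW sB \<beta> i j ((X((k, l) := y)) (i, j))) =
        (\<Sum>(i, j)\<in>?P - {(k, l)}. block_weight sW sB \<beta> i j (X (i, j)))"
    by (intro sum.cong) (auto split: if_splits)
  then show ?thesis
    unfolding lergm_exponent_eq_sum_block_weight
    using sum.remove[of ?P "(k, l)" "\<lambda>(i, j). block_weight sW sB \<beta> i j (X (i, j))"]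
      sum.remove[of ?P "(k, l)" "\<lambda>(i, j). block_weight sW sB \<beta> i j ((X((k, l) := y)) (i, j))"] kl
    by simp
qed

lemma graphs_component:
  assumes "X \<in> graphs A K" "1 \<le> k" "k \<le> l" "l \<le> K"
  shows "X (k, l) \<in> configs A k l"
  using PiE_mem[OF assms(1)[unfolded graphs_def], of "(k, l)"] assms by auto

lemma graphs_upd:
  assumes "X \<in> graphs A K" "1 \<le> k" "k \<le> l" "l \<le> K" "y \<in> configs A k l"
  shows "X((k, l) := y) \<in> graphs A K"
  using assms unfolding graphs_def
  by (auto simp: PiE_iff extensional_def)

lemma configs_upd:
  assumes "y \<in> configs A k l" "m \<in> edges A k l" "i \<in> {0, 1}"
  shows "y(m := i) \<in> configs A k l"
  using assms unfolding configs_def by (auto simp: PiE_iff extensional_def)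

lemma prob_LERGM_eq_sum:
  assumes "block_partition V K A"
  shows "measure_pmf.prob (LERGM A K sW sB \<beta>) S =
    (\<Sum>X\<in>graphs A K \<inter> S. pmf (LERGM A K sW sB \<beta>) X)"
proof -
  have "set_pmf (LERGM A K sW sB \<beta>) \<subseteq> graphs A K"
    by (auto simp: set_pmf_iff pmf_LERGM[OF assms] split: if_splits)
  then have "S \<inter> set_pmf (LERGM A K sW sB \<beta>) = (graphs A K \<inter> S) \<inter> set_pmf (LERGM A K sW sB \<beta>)"
    by blast
  then have "measure_pmf.prob (LERGM A K sW sB \<beta>) S = 
      measure_pmf.prob (LERGM A K sW sB \<beta>) (graphs A K \<inter> S)"
    by (metis measure_Int_set_pmf)
  also have "\<dots> = (\<Sum>X\<in>graphs A K \<inter> S. pmf (LERGM A K sW sB \<beta>) X)"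
    by (intro measure_measure_pmf_finite) (simp add: finite_graphs[OF assms])
  finally show ?thesis .
qed

text \<open>
  Replacing the component \<open>(k, l)\<close> maps the graphs with \<open>X (k, l) = y\<close> bijectively onto those with
  \<open>X (k, l) = y'\<close>, and multiplies every probability by the same factor.
\<close>

lemma config_prob_ratio:
  assumes "block_partition V K A" "1 \<le> k" "k \<le> l" "l \<le> K"
    and "y \<in> configs A k l" "y' \<in> configs A k l"
  shows "measure_pmf.prob (LERGM A K sW sB \<beta>) {X. X (k, l) = y'} =
    exp (block_weight sW sB \<beta> k l y' - block_weight sW sB \<beta> k l y) *
    measure_pmf.prob (LERGM A K sW sB \<beta>) {X. X (k, l) = y}"
proof -
  have "(\<Sum>X\<in>graphs A K \<inter> {X. X (k, l) = y'}. pmf (LERGM A K sW sB \<beta>) X) =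
    (\<Sum>X\<in>graphs A K \<inter> {X. X (k, l) = y}.
       exp (block_weight sW sB \<beta> k l y' - block_weight sW sB \<beta> k l y) * pmf (LERGM A K sW sB \<beta>) X)"
    by (rule sum.reindex_bij_witness[of _ "\<lambda>X. X((k, l) := y')" "\<lambda>X. X((k, l) := y)"])
      (use assms in \<open>auto simp: graphs_upd pmf_LERGM lergm_exponent_upd exp_diff exp_add\<close>)
  then show ?thesis
    by (simp add: prob_LERGM_eq_sum[OF assms(1)] sum_distrib_left)
qed

lemma config_prob:
  assumes "block_partition V K A" "1 \<le> k" "k \<le> l" "l \<le> K"
  obtains c where "c > 0"
    and "\<And>y. y \<in> configs A k l \<Longrightarrow>
      measure_pmf.prob (LERGM A K sW sB \<beta>) {X. X (k, l) = y} = c * exp (block_weight sW sB \<beta> k l y)"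
proof -
  let ?prob = "measure_pmf.prob (LERGM A K sW sB \<beta>)"
  obtain x where x: "x \<in> graphs A K"
    using graphs_nonempty by blast
  have "0 < pmf (LERGM A K sW sB \<beta>) x"
    using x finite_graphs[OF assms(1)]
    by (auto simp: pmf_LERGM[OF assms(1)] intro!: divide_pos_pos sum_pos)
  also have "\<dots> \<le> ?prob {X. X (k, l) = x (k, l)}"
    unfolding measure_pmf_single[symmetric] by (intro measure_pmf.finite_measure_mono) auto
  finally have pos: "?prob {X. X (k, l) = x (k, l)} > 0" .
  show ?thesis
  proof (rule that)
    show "?prob {X. X (k, l) = x (k, l)} * exp (- block_weight sW sB \<beta> k l (x (k, l))) > 0"
      using pos by simp
  next
    fix y assume "y \<in> configs A k l"
    then show "?prob {X. X (k, l) = y} =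
      ?prob {X. X (k, l) = x (k, l)} * exp (- block_weight sW sB \<beta> k l (x (k, l))) *
      exp (block_weight sW sB \<beta> k l y)"
      using config_prob_ratio[OF assms graphs_component[OF x assms(2-4)]]
      by (simp add: exp_diff exp_minus field_simps)
  qed
qed

lemma restrict_eq_iff_upd:
  assumes "y \<in> configs A k l" "z \<in> configs A k l" "m \<in> edges A k l"
  shows "restrict z (edges A k l - {m}) = restrict y (edges A k l - {m}) \<longleftrightarrow>
    z = y(m := 1) \<or> z = y(m := 0)"
proof
  assume eq: "restrict z (edges A k l - {m}) = restrict y (edges A k l - {m})"
  have "z e = (y(m := z m)) e" for e
    using assms fun_cong[OF eq, of e]
    by (cases "e \<in> edges A k l") (auto simp: configs_def PiE_iff extensional_def split: if_splits)
  then have "z = y(m := z m)"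
    by blast
  moreover have "z m = 0 \<or> z m = 1"
    using assms by (auto simp: configs_def)
  ultimately show "z = y(m := 1) \<or> z = y(m := 0)"
    by metis
qed (auto simp: restrict_def)

lemma cond_config_prob_eq:
  assumes "block_partition V K A" "x \<in> graphs A K" "1 \<le> k" "k \<le> l" "l \<le> K" "m \<in> edges A k l"
  shows "cond_config_prob A K sW sB \<beta> k l m x =
    exp (block_weight sW sB \<beta> k l (x (k, l))) /
    (exp (block_weight sW sB \<beta> k l ((x (k, l))(m := 1))) +
     exp (block_weight sW sB \<beta> k l ((x (k, l))(m := 0))))"
proof -
  let ?M = "LERGM A K sW sB \<beta>" and ?w = "block_weight sW sB \<beta> k l"
  let ?E = "edges A k l - {m}"
  define y where "y = x (k, l)"
  have y: "y \<in> configs A k l"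
    unfolding y_def using assms by (intro graphs_component)
  have y1: "y(m := 1) \<in> configs A k l" and y0: "y(m := 0) \<in> configs A k l"
    using configs_upd[OF y assms(6)] by auto
  have ne: "y(m := 1) \<noteq> y(m := 0)"
    by (metis fun_upd_same zero_neq_one)
  obtain c where c: "c > 0"
    and pr: "\<And>z. z \<in> configs A k l \<Longrightarrow>
      measure_pmf.prob ?M {X. X (k, l) = z} = c * exp (?w z)"
    using config_prob[OF assms(1,3-5)] by blast
  have "measure_pmf.prob ?M {X. restrict (X (k, l)) ?E = restrict y ?E} =
    measure_pmf.prob ?M ({X. X (k, l) = y(m := 1)} \<union> {X. X (k, l) = y(m := 0)})"
    unfolding prob_LERGM_eq_sum[OF assms(1)]
    by (intro sum.cong)
      (use restrict_eq_iff_upd[OF y _ assms(6)] graphs_component[OF _ assms(3-5)] in auto)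
  also have "\<dots> = measure_pmf.prob ?M {X. X (k, l) = y(m := 1)} +
      measure_pmf.prob ?M {X. X (k, l) = y(m := 0)}"
    using ne by (intro measure_pmf.finite_measure_Union) auto
  also have "\<dots> = c * (exp (?w (y(m := 1))) + exp (?w (y(m := 0))))"
    by (simp only: pr[OF y1] pr[OF y0] distrib_left)
  finally have den: "measure_pmf.prob ?M {X. restrict (X (k, l)) ?E = restrict y ?E} = \<dots>" .
  have "{X. X (k, l) = y \<and> restrict (X (k, l)) ?E = restrict y ?E} = {X. X (k, l) = y}"
    by auto
  then have "cond_config_prob A K sW sB \<beta> k l m x =
      (c * exp (?w y)) / (c * (exp (?w (y(m := 1))) + exp (?w (y(m := 0)))))"
    using den pr[OF y] by (simp add: cond_config_prob_def cond_prob_def y_def)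
  then show ?thesis
    using c by (simp add: y_def)
qed

lemma ln_logistic:
  "ln (exp s / (exp s1 + exp s0)) = - (softplus (s1 - s0) + (s0 - s))"
proof -
  have "exp s1 + exp s0 = exp s0 * (1 + exp (s1 - s0))"
    by (simp add: exp_diff field_simps)
  moreover have "1 + exp (s1 - s0) > 0"
    by (simp add: add_pos_pos)
  ultimately show ?thesis
    by (simp add: softplus_def ln_div ln_mult)
qed

lemma log_pseudo_likelihood_eq:
  assumes "block_partition V K A" "x \<in> graphs A K"
  shows "log_pseudo_likelihood A K sW sB x \<beta> =
    - (stein_W A K sW x (fst \<beta>) + stein_B A K sB x (snd \<beta>))"
proof -
  define w where "w = block_weight sW sB \<beta>"
  have "log_pseudo_likelihood A K sW sB x \<beta> = (\<Sum>k=1..K. \<Sum>l=k..K. \<Sum>m\<in>edges A k l.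
      - (softplus (w k l ((x (k, l))(m := 1)) - w k l ((x (k, l))(m := 0))) +
         (w k l ((x (k, l))(m := 0)) - w k l (x (k, l)))))"
    unfolding log_pseudo_likelihood_def w_def
    by (intro sum.cong refl) (simp add: cond_config_prob_eq[OF assms] ln_logistic)
  also have "\<dots> = - (stein_W A K sW x (fst \<beta>) + stein_B A K sB x (snd \<beta>))"
    unfolding sum_negf sum_triangle_split
    by (simp add: w_def block_weight_def stein_W_def stein_B_def edge_diff_def inner_diff_right)
  finally show ?thesis .
qed

text \<open>
  Fixing one of the two parameters at its value in the pair shows that the other one is optimal.
\<close>

lemma is_arg_max_separable:
  fixes f :: "'b \<Rightarrow> real" and g :: "'c \<Rightarrow> real"
  shows "is_arg_max (\<lambda>p. - (f (fst p) + g (snd p))) (\<lambda>_. True) (a, b) \<longleftrightarrow>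
    is_arg_min f (\<lambda>_. True) a \<and> is_arg_min g (\<lambda>_. True) b"
proof
  assume max: "is_arg_max (\<lambda>p. - (f (fst p) + g (snd p))) (\<lambda>_. True) (a, b)"
  have le: "f a + g b \<le> f a' + g b'" for a' b'
    using max unfolding is_arg_max_def by (metis fst_conv snd_conv neg_less_iff_less not_less)
  show "is_arg_min f (\<lambda>_. True) a \<and> is_arg_min g (\<lambda>_. True) b"
    using le[of _ b] le[of a] by (auto simp: is_arg_min_def not_less)
next
  assume "is_arg_min f (\<lambda>_. True) a \<and> is_arg_min g (\<lambda>_. True) b"
  then have "f a + g b \<le> f a' + g b'" for a' b'
    by (intro add_mono) (auto simp: is_arg_min_def not_less)
  then show "is_arg_max (\<lambda>p. - (f (fst p) + g (snd p))) (\<lambda>_. True) (a, b)"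
    unfolding is_arg_max_def by (metis fst_conv snd_conv neg_less_iff_less not_less)
qed

theorem mainTheorem5:
  fixes V :: "'a set" and K :: nat and A :: "nat \<Rightarrow> 'a set"
    and sW :: "nat \<Rightarrow> 'a config \<Rightarrow> real ^ 'd1"
    and sB :: "nat \<Rightarrow> nat \<Rightarrow> 'a config \<Rightarrow> real ^ 'd2"
    and x :: "'a graph"
    and bW :: "real ^ 'd1" and bB :: "real ^ 'd2"
  assumes "block_partition V K A"
    and "x \<in> graphs A K"
  shows "lergm_stein_estimator A K sW sB x (bW, bB) \<longleftrightarrow>
         max_pseudo_likelihood_estimator A K sW sB x (bW, bB)"
proof -
  have "log_pseudo_likelihood A K sW sB x =
      (\<lambda>\<beta>. - (stein_W A K sW x (fst \<beta>) + stein_B A K sB x (snd \<beta>)))"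
    using log_pseudo_likelihood_eq[OF assms] by blast
  then show ?thesis
    by (simp only: lergm_stein_estimator_def max_pseudo_likelihood_estimator_def
        is_arg_max_separable fst_conv snd_conv)
qed

end
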